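(* Let $\mathbb{F}$ be a field, let $B=\{\vec b_1,\dots,\vec b_n\}$ and $B'=\{\vec b'_1,\dots,\vec b'_n\}$ be ordered bases of $\mathbb{F}^n$ (possibly equal), and let $\bar\rho(D)$, $m(D)$, $\bar\sigma$, $\bar\mu$ be as defined in the context with respect to $B$ and $B'$. Let $D\subseteq\mathbb{F}^n$ be a linear subspace. Then $$w_H(D)\ge\bar\sigma(\bar\rho(D))\qquad\text{and}\qquad w_H(D)\ge\bar\mu(m(D)).$$
   Context: Let $\ast$ denote the component-wise product on $\mathbb{F}^n$, and let $\perp$ denote the orthogonal space with respect to the usual inner product on $\mathbb{F}^n$. Put $\mathcal I=\{1,\dots,n\}$. For a subspace $D\subseteq\mathbb{F}^n$, $\mathrm{Supp}(D):=\{i\in\mathcal I\mid c_i\ne0\text{ for some }(c_1,\dots,c_n)\in D\}$ and $w_H(D):=\#\mathrm{Supp}(D)$. Set $L_0=\{\vec 0\}$ and $L_i=\mathrm{Span}_{\mathbb{F}}\{\vec b_1,\dots,\vec b_i\}$ for $i=1,\dots,n$. Define $\bar\rho:\mathbb{F}^n\to\{0,1,\dots,n\}$ by $\bar\rho(\vec 0)=0$ and $\bar\rho(\vec c)=i$ if $\vec c\in L_i\setminus L_{i-1}$. For a subspace $D$ define the sets $$\bar\rho(D):=\{e\mid 1\le e\le n,\ \exists\,\vec c\in D\setminus\{\vec 0\}\text{ with }\vec c\in L_e\setminus L_{e-1}\},$$ $$m(D):=\{r\mid 1\le r\le n,\ \exists\,\vec c\in D\setminus\{\vec 0\}\text{ with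 }\vec c\in L_{r-1}^\perp\setminus L_r^\perp\}.$$ A pair $(i,j)\in\mathcal I^2$ is one-way well-behaving (OWB) if $\bar\rho(\vec b_u\ast\vec b'_j)<\bar\rho(\vec b_i\ast\vec b'_j)$ for all $u<i$. For $l,i\in\mathcal I$ define $$V_l:=\{i\in\mathcal I\mid \bar\rho(\vec b_i\ast\vec b'_j)=l\text{ for some }\vec b'_j\in B'\text{ with }(i,j)\text{ OWB}\},$$ $$\Lambda_i:=\{l\in\mathcal I\mid \bar\rho(\vec b_i\ast\vec b'_j)=l\text{ for some }\vec b'_j\in B'\text{ with }(i,j)\text{ OWB}\}.$$ For subsets $\{l_1,\dots,l_k\},\{i_1,\dots,i_k\}\subseteq\mathcal I$ define $$\bar\mu(l_1,\dots,l_k):=\#\Big(\big(\textstyle\bigcup_{s=1}^kV_{l_s}\big)\cup\{l_1,\dots,l_k\}\Big),\qquad \bar\sigma(i_1,\dots,i_k):=\#\Big(\big(\textstyle\bigcup_{s=1}^k\Lambda_{i_s}\big)\cup\{i_1,\dots,i_k\}\Big).$$ For a subset $S\subseteq\mathcal I$, $\bar\mu(S)$ and $\bar\sigma(S)$ mean these functions applied to the elements of $S$ (with value $0$ for $S=\emptyset$). *)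

theory Defs
  imports "HOL-Analysis.Analysis"
begin

text \<open>
  The space of n-tuples over a field is \<open>'f ^ 'n\<close> with \<open>n = CARD('n)\<close>; the product \<open>*\<close> on this type
  is the component-wise one. Ordered bases are families indexed by \<open>{1..CARD('n)}\<close>; values outside
  this range are never used.
\<close>

definition ordered_basis :: "(nat \<Rightarrow> 'f::field ^ 'n) \<Rightarrow> bool" where
  "ordered_basis b \<longleftrightarrow>
     inj_on b {1..CARD('n)} \<and> vec.independent (b ` {1..CARD('n)}) \<and>
     vec.span (b ` {1..CARD('n)}) = UNIV"

definition perp :: "('f::field ^ 'n) set \<Rightarrow> ('f ^ 'n) set" where
  "perp S = {x. \<forall>y\<in>S. scalar_product x y = 0}"

definition Supp :: "('f::field ^ 'n) set \<Rightarrow> 'n set" where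
  "Supp D = {k. \<exists>c\<in>D. c $ k \<noteq> 0}"

definition w_H :: "('f::field ^ 'n) set \<Rightarrow> nat" where
  "w_H D = card (Supp D)"

definition L :: "(nat \<Rightarrow> 'f::field ^ 'n) \<Rightarrow> nat \<Rightarrow> ('f ^ 'n) set" where
  "L b i = vec.span (b ` {1..i})"

text \<open>For an ordered basis the spaces \<open>L b i\<close> increase from zero to the whole space, so the
  index below exists and is unique for every nonzero vector.\<close>

definition rho_bar :: "(nat \<Rightarrow> 'f::field ^ 'n) \<Rightarrow> 'f ^ 'n \<Rightarrow> nat" where
  "rho_bar b c =
     (if c = 0 then 0 else (THE i. i \<in> {1..CARD('n)} \<and> c \<in> L b i - L b (i - 1)))"

definition rho_bar_set :: "(nat \<Rightarrow> 'f::field ^ 'n) \<Rightarrow> ('f ^ 'n) set \<Rightarrow> nat set" where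
  "rho_bar_set b D = {e \<in> {1..CARD('n)}. \<exists>c\<in>D - {0}. c \<in> L b e - L b (e - 1)}"

definition m_set :: "(nat \<Rightarrow> 'f::field ^ 'n) \<Rightarrow> ('f ^ 'n) set \<Rightarrow> nat set" where
  "m_set b D = {r \<in> {1..CARD('n)}. \<exists>c\<in>D - {0}. c \<in> perp (L b (r - 1)) - perp (L b r)}"

definition OWB :: "(nat \<Rightarrow> 'f::field ^ 'n) \<Rightarrow> (nat \<Rightarrow> 'f ^ 'n) \<Rightarrow> nat \<Rightarrow> nat \<Rightarrow> bool" where
  "OWB b b' i j \<longleftrightarrow>
     i \<in> {1..CARD('n)} \<and> j \<in> {1..CARD('n)} \<and>
     (\<forall>u\<in>{1..<i}. rho_bar b (b u * b' j) < rho_bar b (b i * b' j))"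

definition V :: "(nat \<Rightarrow> 'f::field ^ 'n) \<Rightarrow> (nat \<Rightarrow> 'f ^ 'n) \<Rightarrow> nat \<Rightarrow> nat set" where
  "V b b' l =
     {i \<in> {1..CARD('n)}. \<exists>j\<in>{1..CARD('n)}. OWB b b' i j \<and> rho_bar b (b i * b' j) = l}"

definition Lambda :: "(nat \<Rightarrow> 'f::field ^ 'n) \<Rightarrow> (nat \<Rightarrow> 'f ^ 'n) \<Rightarrow> nat \<Rightarrow> nat set" where
  "Lambda b b' i =
     {l \<in> {1..CARD('n)}. \<exists>j\<in>{1..CARD('n)}. OWB b b' i j \<and> rho_bar b (b i * b' j) = l}"

definition mu_bar :: "(nat \<Rightarrow> 'f::field ^ 'n) \<Rightarrow> (nat \<Rightarrow> 'f ^ 'n) \<Rightarrow> nat set \<Rightarrow> nat" where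
  "mu_bar b b' S = card ((\<Union>l\<in>S. V b b' l) \<union> S)"

definition sigma_bar :: "(nat \<Rightarrow> 'f::field ^ 'n) \<Rightarrow> (nat \<Rightarrow> 'f ^ 'n) \<Rightarrow> nat set \<Rightarrow> nat" where
  "sigma_bar b b' S = card ((\<Union>i\<in>S. Lambda b b' i) \<union> S)"

end

theory Submission
  imports Defs
begin

text \<open>
  Enlarge \<open>D\<close> to the space \<open>W\<close> of all vectors that vanish outside \<open>Supp D\<close>, which has dimension
  \<open>w_H D\<close>. Unlike \<open>D\<close> in general, \<open>W\<close> is closed under component-wise multiplication by arbitrary
  vectors. So it contains the products \<open>c * b' j\<close> with \<open>c \<in> D\<close>, and both bounds follow by counting
  how often a chain of subspaces can jump on \<open>W\<close>.

  If \<open>(i, j)\<close> is one-way well-behaving with \<open>rho_bar b (b i * b' j) = l \<ge> 1\<close>, then multiplication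
  by \<open>b' j\<close> sends \<open>L b (i - 1)\<close> into \<open>L b (l - 1)\<close>, and sends \<open>b i\<close> to a vector that spans \<open>L b l\<close>
  modulo \<open>L b (l - 1)\<close> (lemmas \<open>OWB_product_mem\<close> and \<open>OWB_product_leading\<close>). It therefore carries
  vectors of index \<open>i\<close> to vectors of index \<open>l\<close>. It is also self-adjoint for the scalar product,
  so it carries vectors in \<open>perp (L b (l - 1)) - perp (L b l)\<close> to vectors in
  \<open>perp (L b (i - 1)) - perp (L b i)\<close>.
  Since \<open>D \<subseteq> W\<close>, the indices of \<open>D\<close> itself also occur in \<open>W\<close>. So each element counted by \<open>sigma_bar\<close> is an index at which the chain \<open>L b\<close> jumps on \<open>W\<close>,
  and each element counted by \<open>mu_bar\<close> is one at which the chain \<open>perp \<circ> L b\<close> drops on \<open>W\<close>.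
  Each jump or drop changes the dimension of the intersection with \<open>W\<close> by at least one, so
  neither count can exceed \<open>dim W = w_H D\<close>.
\<close>

section \<open>Jumps of a chain of subspaces\<close>

lemma card_jumps_le_dim:
  fixes F :: "nat \<Rightarrow> ('f::field ^ 'n) set"
  assumes F: "\<And>k. vec.subspace (F k)" and mono: "\<And>k. F k \<subseteq> F (Suc k)"
    and W: "vec.subspace W"
  shows "card {r \<in> {1..k}. \<exists>c\<in>W. c \<in> F r - F (r - 1)} \<le> vec.dim (W \<inter> F k)"
proof (induction k)
  case 0
  show ?case by simp
next
  case (Suc k)
  let ?J = "\<lambda>k. {r \<in> {1..k}. \<exists>c\<in>W. c \<in> F r - F (r - 1)}"
  have sub: "vec.subspace (W \<inter> F i)" for i
    by (intro vec.subspace_inter W F)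
  show ?case
  proof (cases "\<exists>c\<in>W. c \<in> F (Suc k) - F k")
    case True
    then have "W \<inter> F k \<subset> W \<inter> F (Suc k)" using mono[of k] by blast
    then have "vec.span (W \<inter> F k) \<subset> vec.span (W \<inter> F (Suc k))"
      using sub by (simp add: vec.span_eq_iff[THEN iffD2])
    then have "vec.dim (W \<inter> F k) < vec.dim (W \<inter> F (Suc k))"
      by (rule vec.dim_psubset)
    moreover have "?J (Suc k) = insert (Suc k) (?J k)"
      using True by (auto simp: le_Suc_eq)
    ultimately show ?thesis using Suc.IH by simp
  next
    case False
    then have "?J (Suc k) = ?J k" by (auto simp: le_Suc_eq)
    moreover have "vec.dim (W \<inter> F k) \<le> vec.dim (W \<inter> F (Suc k))"
      using mono[of k] by (intro vec.dim_subset) blast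
    ultimately show ?thesis using Suc.IH by simp
  qed
qed

text \<open>A decreasing chain becomes an increasing one when it is read backwards.\<close>

lemma card_drops_le_dim:
  fixes F :: "nat \<Rightarrow> ('f::field ^ 'n) set"
  assumes F: "\<And>k. vec.subspace (F k)" and anti: "\<And>k. F (Suc k) \<subseteq> F k"
    and W: "vec.subspace W"
  shows "card {r \<in> {1..k}. \<exists>c\<in>W. c \<in> F (r - 1) - F r} \<le> vec.dim W"
proof -
  let ?G = "\<lambda>i. F (k - i)"
  let ?A = "{r \<in> {1..k}. \<exists>c\<in>W. c \<in> F (r - 1) - F r}"
  let ?B = "{r \<in> {1..k}. \<exists>c\<in>W. c \<in> ?G r - ?G (r - 1)}"
  have mono: "?G i \<subseteq> ?G (Suc i)" for i
  proof (cases "i < k")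
    case True
    then have "k - i = Suc (k - Suc i)" by simp
    then show ?thesis using anti by metis
  qed simp
  \<comment> \<open>The step between \<open>F (r - 1)\<close> and \<open>F r\<close> is step number \<open>k + 1 - r\<close> of the reversed chain.\<close>
  have "(\<lambda>r. Suc k - r) ` ?A \<subseteq> ?B"
  proof
    fix s assume "s \<in> (\<lambda>r. Suc k - r) ` ?A"
    then obtain r where r: "r \<in> ?A" and s: "s = Suc k - r" by blast
    then have "k - s = r - 1" "k - (s - 1) = r" "s \<in> {1..k}" by auto
    then show "s \<in> ?B" using r by simp
  qed
  moreover have "inj_on (\<lambda>r. Suc k - r) ?A" by (auto simp: inj_on_def)
  ultimately have "card ?A \<le> card ?B" by (intro card_inj_on_le) auto
  also have "\<dots> \<le> vec.dim (W \<inter> ?G k)"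
    by (rule card_jumps_le_dim[of ?G]) (use F mono W in auto)
  also have "\<dots> \<le> vec.dim W" by (intro vec.dim_subset) blast
  finally show ?thesis .
qed

section \<open>The coordinate subspace of a support\<close>

definition coord_subspace :: "'n set \<Rightarrow> ('f::field ^ 'n) set" where
  "coord_subspace A = {x. \<forall>k. k \<notin> A \<longrightarrow> x $ k = 0}"

lemma subspace_coord_subspace: "vec.subspace (coord_subspace A)"
  by (auto simp: coord_subspace_def vec.subspace_def)

lemma dim_coord_subspace_le: "vec.dim (coord_subspace A :: ('f::field ^ 'n) set) \<le> card A"
proof -
  let ?E = "(\<lambda>k. axis k 1 :: 'f ^ 'n) ` A"
  have "coord_subspace A \<subseteq> vec.span ?E"
  proof
    fix x :: "'f ^ 'n" assume x: "x \<in> coord_subspace A"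
    have "x $ k *s axis k 1 \<in> vec.span ?E" for k
      using x by (cases "k \<in> A")
        (auto simp: coord_subspace_def intro: vec.span_scale vec.span_base vec.span_zero)
    then have "(\<Sum>k\<in>UNIV. x $ k *s axis k 1) \<in> vec.span ?E"
      by (rule vec.span_sum)
    then show "x \<in> vec.span ?E" by (simp add: basis_expansion)
  qed
  then have "vec.dim (coord_subspace A :: ('f ^ 'n) set) \<le> card ?E"
    by (intro vec.dim_le_card) auto
  also have "\<dots> \<le> card A" by (intro card_image_le) simp
  finally show ?thesis .
qed

lemma subset_coord_subspace_Supp: "D \<subseteq> coord_subspace (Supp D)"
  by (auto simp: coord_subspace_def Supp_def)

lemma coord_subspace_times: "x \<in> coord_subspace A \<Longrightarrow> x * y \<in> coord_subspace A"
  by (auto simp: coord_subspace_def)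

section \<open>The filtration and its index function\<close>

lemma subspace_L: "vec.subspace (L b i)"
  by (simp add: L_def)

lemma L_mono: "i \<le> j \<Longrightarrow> L b i \<subseteq> L b j"
  unfolding L_def by (intro vec.span_mono image_mono) auto

lemma L_step:
  assumes "l \<ge> 1"
  shows "L b l = vec.span (insert (b l) (b ` {1..l - 1}))"
proof -
  have "{1..l} = insert l {1..l - 1}" using assms by auto
  then show ?thesis by (simp only: L_def image_insert)
qed

text \<open>The exchange property: \<open>L b l\<close> exceeds \<open>L b (l - 1)\<close> by at most one dimension, so any
  vector in the difference generates the quotient.\<close>

lemma L_diff_generates:
  assumes "l \<ge> 1" "x \<in> L b l - L b (l - 1)" "y \<in> L b l"
  obtains k where "y - k *s x \<in> L b (l - 1)"
proof -
  let ?S = "b ` {1..l - 1}"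
  have x: "x \<in> vec.span (insert (b l) ?S)" "x \<notin> vec.span ?S"
    using assms(2) L_step[OF assms(1), of b] unfolding L_def by blast+
  then have "b l \<in> vec.span (insert x ?S)" by (rule vec.in_span_insert)
  then have "insert (b l) ?S \<subseteq> vec.span (insert x ?S)"
    using vec.span_superset[of "insert x ?S"] by blast
  then have "vec.span (insert (b l) ?S) \<subseteq> vec.span (insert x ?S)"
    by (rule vec.span_minimal) simp
  then have "y \<in> vec.span (insert x ?S)"
    using assms(3) L_step[OF assms(1), of b] by blast
  then obtain k where "y - k *s x \<in> vec.span ?S"
    unfolding vec.span_insert by blast
  then show thesis using that unfolding L_def by blast
qed

text \<open>All uses of \<open>rho_bar\<close> go through this equivalence, which hides the definite description.\<close>

lemma rho_bar_le_iff:
  fixes b :: "nat \<Rightarrow> 'f::field ^ 'n"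
  assumes "ordered_basis b"
  shows "rho_bar b x \<le> k \<longleftrightarrow> x \<in> L b k"
proof (cases "x = 0")
  case True
  then show ?thesis by (simp add: rho_bar_def vec.subspace_0[OF subspace_L])
next
  case False
  define e where "e = (LEAST i. x \<in> L b i)"
  have top: "x \<in> L b CARD('n)" using assms by (simp add: ordered_basis_def L_def)
  have e: "x \<in> L b e" unfolding e_def using top by (rule LeastI)
  have le: "e \<le> i" if "x \<in> L b i" for i unfolding e_def using that by (rule Least_le)
  have "e \<noteq> 0" using e False by (auto simp: L_def intro: gr0I)
  then have "x \<notin> L b (e - 1)" using le[of "e - 1"] by auto
  have "rho_bar b x = (THE i. i \<in> {1..CARD('n)} \<and> x \<in> L b i - L b (i - 1))"
    using False by (simp add: rho_bar_def)
  also have "\<dots> = e"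
  proof (rule the_equality)
    show "e \<in> {1..CARD('n)} \<and> x \<in> L b e - L b (e - 1)"
      using \<open>e \<noteq> 0\<close> \<open>x \<notin> L b (e - 1)\<close> e le[OF top] by auto
  next
    fix i assume i: "i \<in> {1..CARD('n)} \<and> x \<in> L b i - L b (i - 1)"
    have "\<not> e \<le> i - 1" using i e L_mono[of e "i - 1" b] by auto
    with i le[of i] show "i = e" by auto
  qed
  finally have "rho_bar b x = e" .
  then show ?thesis using e le[of k] L_mono[of e k b] by auto
qed

corollary rho_bar_eq_mem_diff:
  fixes b :: "nat \<Rightarrow> 'f::field ^ 'n"
  assumes "ordered_basis b" "rho_bar b x = l" "l \<ge> 1"
  shows "x \<in> L b l - L b (l - 1)"
  using assms(2,3) by (simp add: rho_bar_le_iff[OF assms(1), symmetric])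

section \<open>Multiplication by the second factor of a well-behaving pair\<close>

lemma smult_times: "(k *s x) * y = k *s (x * (y :: 'f::field ^ 'n))"
  by (simp add: vec_eq_iff mult.assoc)

lemma times_mem_of_generators:
  fixes p :: "'f::field ^ 'n"
  assumes "\<And>u. u \<in> {1..i} \<Longrightarrow> b u * p \<in> T" "vec.subspace T" "y \<in> L b i"
  shows "y * p \<in> T"
proof -
  have "vec.subspace {v. v * p \<in> T}"
    using assms(2) by (simp add: vec.subspace_def distrib_right smult_times)
  moreover have "b ` {1..i} \<subseteq> {v. v * p \<in> T}" using assms(1) by auto
  ultimately have "vec.span (b ` {1..i}) \<subseteq> {v. v * p \<in> T}"
    by (intro vec.span_minimal)
  then show ?thesis using assms(3) by (auto simp: L_def)
qed

lemma OWB_product_mem: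
  fixes b :: "nat \<Rightarrow> 'f::field ^ 'n"
  assumes b: "ordered_basis b" and owb: "OWB b b' i j"
    and l: "rho_bar b (b i * b' j) = l" "l \<ge> 1"
  shows "y \<in> L b (i - 1) \<Longrightarrow> y * b' j \<in> L b (l - 1)"
    and "y \<in> L b i \<Longrightarrow> y * b' j \<in> L b l"
proof -
  have low: "b u * b' j \<in> L b (l - 1)" if "u \<in> {1..<i}" for u
  proof -
    have "rho_bar b (b u * b' j) < l" using owb l(1) that by (simp add: OWB_def)
    then have "rho_bar b (b u * b' j) \<le> l - 1" by simp
    then show ?thesis by (simp only: rho_bar_le_iff[OF b])
  qed
  show "y * b' j \<in> L b (l - 1)" if "y \<in> L b (i - 1)"
    by (rule times_mem_of_generators[OF _ subspace_L that], rule low) auto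
  have "b u * b' j \<in> L b l" if "u \<in> {1..i}" for u
  proof (cases "u = i")
    case True
    then show ?thesis using rho_bar_eq_mem_diff[OF b l] by simp
  next
    case False
    then show ?thesis using low[of u] that L_mono[of "l - 1" l b] by auto
  qed
  then show "y * b' j \<in> L b l" if "y \<in> L b i"
    by (rule times_mem_of_generators[OF _ subspace_L that])
qed

text \<open>Because \<open>b i\<close> is a multiple of \<open>c\<close> modulo \<open>L b (i - 1)\<close>, the product \<open>c * b' j\<close> cannot fall
  into \<open>L b (l - 1)\<close> without \<open>b i * b' j\<close> doing the same.\<close>

lemma OWB_product_leading:
  fixes b :: "nat \<Rightarrow> 'f::field ^ 'n"
  assumes b: "ordered_basis b" and owb: "OWB b b' i j"
    and l: "rho_bar b (b i * b' j) = l" "l \<ge> 1"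
    and c: "c \<in> L b i - L b (i - 1)"
  shows "c * b' j \<in> L b l - L b (l - 1)"
proof
  show "c * b' j \<in> L b l"
    using OWB_product_mem(2)[OF b owb l] c by blast
  show "c * b' j \<notin> L b (l - 1)"
  proof
    assume mem: "c * b' j \<in> L b (l - 1)"
    have i: "i \<ge> 1" using owb by (simp add: OWB_def)
    then have "b i \<in> L b i" by (auto simp: L_def intro: vec.span_base)
    then obtain k where "b i - k *s c \<in> L b (i - 1)"
      using L_diff_generates[OF i c] by blast
    then have "(b i - k *s c) * b' j \<in> L b (l - 1)"
      by (rule OWB_product_mem(1)[OF b owb l])
    moreover have "k *s (c * b' j) \<in> L b (l - 1)"
      using mem by (rule vec.subspace_scale[OF subspace_L])
    ultimately have "(b i - k *s c) * b' j + k *s (c * b' j) \<in> L b (l - 1)"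
      by (rule vec.subspace_add[OF subspace_L])
    then have "b i * b' j \<in> L b (l - 1)"
      by (simp add: left_diff_distrib smult_times)
    then show False using rho_bar_eq_mem_diff[OF b l] by blast
  qed
qed

section \<open>The dual filtration\<close>

lemma scalar_product_add_right:
  "scalar_product c (x + y) = scalar_product c x + scalar_product c (y :: 'f::field ^ 'n)"
  by (simp add: scalar_product_def distrib_left sum.distrib)

lemma scalar_product_smult_right:
  "scalar_product c (k *s x) = k * scalar_product c (x :: 'f::field ^ 'n)"
  by (simp add: scalar_product_def sum_distrib_left mult.left_commute)

lemma scalar_product_times_left:
  "scalar_product (c * p) y = scalar_product c (y * (p :: 'f::field ^ 'n))"
  by (simp add: scalar_product_def mult_ac)

lemma subspace_perp: "vec.subspace (perp S)"
  by (simp add: vec.subspace_def perp_def scalar_product_def distrib_right sum.distrib mult.assoc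
      flip: sum_distrib_left)

lemma perp_antimono: "S \<subseteq> T \<Longrightarrow> perp T \<subseteq> perp S"
  by (auto simp: perp_def)

text \<open>The dual of \<open>OWB_product_leading\<close>, with \<open>i\<close> and \<open>l\<close> exchanged because multiplication by
  \<open>b' j\<close> is self-adjoint. The vector \<open>c\<close> induces a nonzero functional on the line
  \<open>L b l / L b (l - 1)\<close>, which is generated by \<open>b i * b' j\<close>; hence \<open>c * b' j\<close> does not
  annihilate \<open>b i\<close>.\<close>

lemma OWB_product_perp:
  fixes b :: "nat \<Rightarrow> 'f::field ^ 'n"
  assumes b: "ordered_basis b" and owb: "OWB b b' i j"
    and l: "rho_bar b (b i * b' j) = l" "l \<ge> 1"
    and c: "c \<in> perp (L b (l - 1)) - perp (L b l)"
  shows "c * b' j \<in> perp (L b (i - 1)) - perp (L b i)"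
proof
  show "c * b' j \<in> perp (L b (i - 1))"
    using c OWB_product_mem(1)[OF b owb l] by (auto simp: perp_def scalar_product_times_left)
  obtain y where y: "y \<in> L b l" "scalar_product c y \<noteq> 0"
    using c by (auto simp: perp_def)
  obtain k where "y - k *s (b i * b' j) \<in> L b (l - 1)"
    using L_diff_generates[OF l(2) rho_bar_eq_mem_diff[OF b l] y(1)] by blast
  then have "scalar_product c (y - k *s (b i * b' j)) = 0"
    using c by (auto simp: perp_def)
  then have "scalar_product c y = k * scalar_product c (b i * b' j)"
    using scalar_product_add_right[of c "y - k *s (b i * b' j)" "k *s (b i * b' j)"]
    by (simp add: scalar_product_smult_right)
  then have "scalar_product (c * b' j) (b i) \<noteq> 0"
    using y(2) by (auto simp: scalar_product_times_left)
  moreover have "b i \<in> L b i"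
    using owb by (auto simp: OWB_def L_def intro: vec.span_base)
  ultimately show "c * b' j \<notin> perp (L b i)" by (auto simp: perp_def)
qed

section \<open>The support bounds\<close>

theorem theorem15:
  fixes b b' :: "nat \<Rightarrow> 'f::field ^ 'n"
    and D :: "('f ^ 'n) set"
  assumes "ordered_basis b" and "ordered_basis b'" and "vec.subspace D"
  shows "w_H D \<ge> sigma_bar b b' (rho_bar_set b D) \<and> w_H D \<ge> mu_bar b b' (m_set b D)"
proof
  let ?W = "coord_subspace (Supp D) :: ('f ^ 'n) set"
  note b = assms(1)
  have DW: "c \<in> ?W" if "c \<in> D" for c using that subset_coord_subspace_Supp by blast
  have dimW: "vec.dim ?W \<le> w_H D" unfolding w_H_def by (rule dim_coord_subspace_le)
  let ?R = "{r \<in> {1..CARD('n)}. \<exists>c\<in>?W. c \<in> L b r - L b (r - 1)}"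
  let ?M = "{r \<in> {1..CARD('n)}. \<exists>c\<in>?W. c \<in> perp (L b (r - 1)) - perp (L b r)}"
  show "sigma_bar b b' (rho_bar_set b D) \<le> w_H D"
  proof -
    have "l \<in> ?R" if i: "i \<in> rho_bar_set b D" and l: "l \<in> Lambda b b' i" for i l
    proof -
      obtain j where j: "OWB b b' i j" "rho_bar b (b i * b' j) = l" and "l \<in> {1..CARD('n)}"
        using l by (auto simp: Lambda_def)
      obtain c where "c \<in> D" "c \<in> L b i - L b (i - 1)"
        using i by (auto simp: rho_bar_set_def)
      then show ?thesis
        using OWB_product_leading[OF b j] \<open>l \<in> {1..CARD('n)}\<close> coord_subspace_times[OF DW]
        by (auto intro!: bexI[of _ "c * b' j"])
    qed
    moreover have "rho_bar_set b D \<subseteq> ?R" using DW by (auto simp: rho_bar_set_def)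
    ultimately have "sigma_bar b b' (rho_bar_set b D) \<le> card ?R"
      unfolding sigma_bar_def by (intro card_mono) auto
    also have "\<dots> \<le> vec.dim (?W \<inter> L b CARD('n))"
      by (rule card_jumps_le_dim[of "L b"]) (simp_all add: subspace_L subspace_coord_subspace L_mono)
    also have "\<dots> \<le> vec.dim ?W" by (intro vec.dim_subset) blast
    finally show ?thesis using dimW by linarith
  qed
  show "mu_bar b b' (m_set b D) \<le> w_H D"
  proof -
    have "i \<in> ?M" if l: "l \<in> m_set b D" and i: "i \<in> V b b' l" for i l
    proof -
      obtain j where j: "OWB b b' i j" "rho_bar b (b i * b' j) = l" and "i \<in> {1..CARD('n)}"
        using i by (auto simp: V_def)
      obtain c where "c \<in> D" "c \<in> perp (L b (l - 1)) - perp (L b l)" "l \<ge> 1"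
        using l by (auto simp: m_set_def)
      then show ?thesis
        using OWB_product_perp[OF b j] \<open>i \<in> {1..CARD('n)}\<close> coord_subspace_times[OF DW]
        by (auto intro!: bexI[of _ "c * b' j"])
    qed
    moreover have "m_set b D \<subseteq> ?M" using DW by (auto simp: m_set_def)
    ultimately have "mu_bar b b' (m_set b D) \<le> card ?M"
      unfolding mu_bar_def by (intro card_mono) auto
    also have "\<dots> \<le> vec.dim ?W"
      by (rule card_drops_le_dim[of "\<lambda>r. perp (L b r)"])
        (simp_all add: subspace_perp subspace_coord_subspace perp_antimono L_mono)
    finally show ?thesis using dimW by linarith
  qed
qed

end
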